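(* Let $n\ge 1$. For each $\mathcal{H}=\begin{pmatrix}A&B\\ C&D\end{pmatrix}\in \mathrm{Sp}(2n,\mathbb{R})$ there exists a real-valued quadratic form $\Phi:\mathbb{C}^n_z\times\mathbb{R}^{2n}_\theta\to\mathbb{R}$ (a quadratic form over $\mathbb{R}$) such that $$\mathrm{graph}_{\mathbb{C}}\mathcal{H}=\left\{\left(z,-2\tfrac{\partial\Phi}{\partial z}(z,\theta)\right);\ z\in\mathbb{C}^n,\ \theta\in\mathbb{R}^{2n},\ \tfrac{\partial\Phi}{\partial\theta}(z,\theta)=0\right\},$$ and such that $\omega^{\mathbb{C}}|_{\mathrm{graph}_{\mathbb{C}}\mathcal{H}}$ is given as follows: for all $(z,\theta),(w,\eta)\in\mathbb{C}^n\times\mathbb{R}^{2n}$ with $\tfrac{\partial\Phi}{\partial\theta}(z,\theta)=0$ and $\tfrac{\partial\Phi}{\partial\theta}(w,\eta)=0$, $$\omega^{\mathbb{C}}\left(\left(z,-2\tfrac{\partial\Phi}{\partial z}(z,\theta)\right),\left(w,-2\tfrac{\partial\Phi}{\partial z}(w,\eta)\right)\right)=2\sum_{j=1}^{n}\sum_{\ell=1}^{2n}\frac{\partial^{2}\Phi}{\partial z_{j}\partial\theta_{\ell}}(z_{j}\eta_{\ell}-w_{j}\theta_{\ell})+2\sum_{j,m=1}^{n}\frac{\partial^{2}\Phi}{\partial z_{j}\partial\overline{z}_{m}}(z_{j}\overline{w}_{m}-w_{j}\overline{z}_{m}).$$ Moreover, such a $\Phi$ is given by the explicit formula $$\Phi(z,\theta)=\sum_{j=1}^{k}\theta'_j\,t'_j(z)+F(t''(z))+\sum_{i=k+1}^{2n}\left(\theta''_i-f''_i(t''(z))\right)^2,$$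 where $k=\dim\ker B$, $\theta=(\theta'_1,\dots,\theta'_k,\theta''_{k+1},\dots,\theta''_{2n})$, and $t'(z)$, $t''(z)$, $F$, $f''$ are the explicit functions (depending on $\mathcal{H}$ and a choice of orthonormal basis) defined in the context.
   Context: $\mathrm{Sp}(2n,\mathbb{R})$ is the group of real $2n\times 2n$ matrices $\mathcal{H}$ with $\mathcal{H}^T\mathcal{J}\mathcal{H}=\mathcal{J}$, $\mathcal{J}=\begin{pmatrix}0&-I\\ I&0\end{pmatrix}$; $A,B,C,D$ denote the $n\times n$ blocks of $\mathcal{H}$. On $\mathbb{C}^n_z\times\mathbb{C}^n_\zeta$ the complex symplectic form is $\omega^{\mathbb{C}}=\sum_{j=1}^n d\zeta_j\wedge dz_j$, i.e. $\omega^{\mathbb{C}}((z,\zeta),(z',\zeta'))=\sum_{j=1}^n(\zeta_jz'_j-z_j\zeta'_j)$. The complex graph of $\mathcal{H}$ is the real-linear subspace $\mathrm{graph}_{\mathbb{C}}\mathcal{H}=\{(x+i(Ax+B\xi),\ \xi+i(Cx+D\xi));\ (x,\xi)\in\mathbb{R}^n\times\mathbb{R}^n\}\subset\mathbb{C}^n_z\times\mathbb{C}^n_\zeta$. Derivatives: $\frac{\partial}{\partial z_j}=\frac12\left(\frac{\partial}{\partial \mathrm{Re}\,z_j}-i\frac{\partial}{\partial\mathrm{Im}\,z_j}\right)$, $\frac{\partial}{\partial\overline z_j}=\frac12\left(\frac{\partial}{\partial\mathrm{Re}\,z_j}+i\frac{\partial}{\partial\mathrm{Im}\,z_j}\right)$;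 $\frac{\partial\Phi}{\partial z}$ and $\frac{\partial\Phi}{\partial\theta}$ are the vectors of partial derivatives. Second derivatives of the quadratic form $\Phi$ are constants. Data for the explicit formula. Let $k=\dim\ker B$, let $\{b_1,\dots,b_k\}$ be an orthonormal basis of $\ker B$, extended to an orthonormal basis $\{b_1,\dots,b_n\}$ of $\mathbb{R}^n$. For $J\in\{k+1,\dots,n\}$ let $\beta_J\in\mathbb{R}^n$ be the unique vector orthogonal to all of $Ab_1,\dots,Ab_k$ and all $Bb_j$ with $j\in\{k+1,\dots,n\}$, $j\ne J$, and satisfying $\beta_J\cdot Bb_J=1$. Define, for $z\in\mathbb{C}^n$, $$t'_j(z)=-b_j\cdot\mathrm{Re}\,z+Db_j\cdot\mathrm{Im}\,z\ (1\le j\le k),\quad t''_j(z)=-A^T\beta_j\cdot\mathrm{Re}\,z+\beta_j\cdot\mathrm{Im}\,z\ (k+1\le j\le n),\quad t''_{n+j}(z)=b_j\cdot\mathrm{Re}\,z\ (1\le j\le n),$$ so $t''=(t''_{k+1},\dots,t''_{2n})$. Define $$f''_i(t'')=\sum_{j=k+1}^n[Bb_i\cdot Db_j]t''_j+\sum_{j=1}^n[Bb_i\cdot Cb_j]t''_{n+j}\quad(k+1\le i\le n),$$ $$f''_{n+i}(t'')=\sum_{j=k+1}^n[Cb_i\cdot Bb_j]t''_j+\sum_{j=1}^n[Ab_i\cdot Cb_j]t''_{n+j}\quad(1\le i\le n),$$ $$F(t'')=\frac12\sum_{i,j=k+1}^n t''_i[Bb_i\cdot Db_j]t''_j+\sum_{i=k+1}^n\sum_{j=1}^n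 t''_i[Bb_i\cdot Cb_j]t''_{n+j}+\frac12\sum_{i,j=1}^n t''_{n+i}[Ab_i\cdot Cb_j]t''_{n+j}.$$ *)

theory Defs
  imports "HOL-Analysis.Analysis"
begin

text \<open>
  The dimension is \<open>n = CARD('n) \<ge> 1\<close>. The index type \<open>'n + 'n\<close> plays the role of
  \<open>{1, \<dots>, 2n}\<close>, with \<open>Inl j\<close> standing for \<open>j\<close> and \<open>Inr j\<close> for \<open>n + j\<close>.
\<close>

definition block_matrix ::
    "real^'n^'n \<Rightarrow> real^'n^'n \<Rightarrow> real^'n^'n \<Rightarrow> real^'n^'n \<Rightarrow> real^('n::finite + 'n)^('n + 'n)" where
  "block_matrix A B C D = (\<chi> p q. case p of
       Inl i \<Rightarrow> (case q of Inl j \<Rightarrow> A $ i $ j | Inr j \<Rightarrow> B $ i $ j)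
     | Inr i \<Rightarrow> (case q of Inl j \<Rightarrow> C $ i $ j | Inr j \<Rightarrow> D $ i $ j))"

definition symplectic_J :: "real^('n::finite + 'n)^('n + 'n)" where
  "symplectic_J = block_matrix 0 (- mat 1) (mat 1) 0"

definition Sp :: "(real^('n::finite + 'n)^('n + 'n)) set" where
  "Sp = {H. transpose H ** symplectic_J ** H = symplectic_J}"

definition complex_vec :: "real^'n \<Rightarrow> real^'n \<Rightarrow> complex^'n" where
  "complex_vec x y = (\<chi> j. Complex (x $ j) (y $ j))"

definition Re_vec :: "complex^'n \<Rightarrow> real^'n" where
  "Re_vec z = (\<chi> j. Re (z $ j))"

definition Im_vec :: "complex^'n \<Rightarrow> real^'n" where
  "Im_vec z = (\<chi> j. Im (z $ j))"

definition omegaC :: "(complex^'n) \<times> (complex^'n) \<Rightarrow> (complex^'n) \<times> (complex^'n) \<Rightarrow> complex" where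
  "omegaC = (\<lambda>(z, \<zeta>) (z', \<zeta>'). \<Sum>j\<in>UNIV. \<zeta> $ j * z' $ j - z $ j * \<zeta>' $ j)"

definition graphC ::
    "real^'n^'n \<Rightarrow> real^'n^'n \<Rightarrow> real^'n^'n \<Rightarrow> real^'n^'n \<Rightarrow> ((complex^'n) \<times> (complex^'n)) set" where
  "graphC A B C D =
     {(complex_vec x (A *v x + B *v \<xi>), complex_vec \<xi> (C *v x + D *v \<xi>)) | x \<xi>. True}"

definition quadratic_form :: "('v::real_vector \<Rightarrow> real) \<Rightarrow> bool" where
  "quadratic_form Q \<longleftrightarrow> (\<exists>\<beta>. bilinear \<beta> \<and> (\<forall>x. Q x = \<beta> x x))"

definition deriv_along ::
    "'v::real_normed_vector \<Rightarrow> ('v \<Rightarrow> 'b::real_normed_vector) \<Rightarrow> 'v \<Rightarrow> 'b" where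
  "deriv_along v f p = vector_derivative (\<lambda>t. f (p + t *\<^sub>R v)) (at 0)"

definition d_z :: "'n \<Rightarrow> ((complex^'n) \<times> (real^'m) \<Rightarrow> complex) \<Rightarrow> (complex^'n) \<times> (real^'m) \<Rightarrow> complex" where
  "d_z j f p = (deriv_along (axis j 1, 0) f p - \<i> * deriv_along (axis j \<i>, 0) f p) / 2"

definition d_zbar :: "'n \<Rightarrow> ((complex^'n) \<times> (real^'m) \<Rightarrow> complex) \<Rightarrow> (complex^'n) \<times> (real^'m) \<Rightarrow> complex" where
  "d_zbar j f p = (deriv_along (axis j 1, 0) f p + \<i> * deriv_along (axis j \<i>, 0) f p) / 2"

definition d_theta :: "'m \<Rightarrow> ((complex^'n) \<times> (real^'m) \<Rightarrow> 'b::real_normed_vector) \<Rightarrow>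
    (complex^'n) \<times> (real^'m) \<Rightarrow> 'b" where
  "d_theta l f p = deriv_along (0, axis l 1) f p"

definition grad_z :: "((complex^'n) \<times> (real^'m) \<Rightarrow> real) \<Rightarrow> (complex^'n) \<times> (real^'m) \<Rightarrow> complex^'n" where
  "grad_z \<Phi> p = (\<chi> j. d_z j (\<lambda>q. complex_of_real (\<Phi> q)) p)"

definition grad_theta :: "((complex^'n) \<times> (real^'m) \<Rightarrow> real) \<Rightarrow> (complex^'n) \<times> (real^'m) \<Rightarrow> real^'m" where
  "grad_theta \<Phi> p = (\<chi> l. d_theta l \<Phi> p)"

definition generates_graph ::
    "((complex^'n) \<times> (real^('n::finite + 'n)) \<Rightarrow> real) \<Rightarrow>
     real^'n^'n \<Rightarrow> real^'n^'n \<Rightarrow> real^'n^'n \<Rightarrow> real^'n^'n \<Rightarrow> bool" where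
  "generates_graph \<Phi> A B C D \<longleftrightarrow>
     graphC A B C D = {(z, - 2 *\<^sub>R grad_z \<Phi> (z, \<theta>)) | z \<theta>. grad_theta \<Phi> (z, \<theta>) = 0}"

text \<open>
  The second derivatives of a quadratic form are constant; accordingly they are evaluated at an
  arbitrary point \<open>p\<close>.
\<close>

definition omega_formula :: "((complex^'n) \<times> (real^('n::finite + 'n)) \<Rightarrow> real) \<Rightarrow> bool" where
  "omega_formula \<Phi> \<longleftrightarrow>
     (\<forall>z \<theta> w \<eta> p. grad_theta \<Phi> (z, \<theta>) = 0 \<longrightarrow> grad_theta \<Phi> (w, \<eta>) = 0 \<longrightarrow>
        omegaC (z, - 2 *\<^sub>R grad_z \<Phi> (z, \<theta>)) (w, - 2 *\<^sub>R grad_z \<Phi> (w, \<eta>)) =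
          2 * (\<Sum>j\<in>UNIV. \<Sum>l\<in>UNIV.
                 d_z j (d_theta l (\<lambda>q. complex_of_real (\<Phi> q))) p
                   * (z $ j * complex_of_real (\<eta> $ l) - w $ j * complex_of_real (\<theta> $ l)))
        + 2 * (\<Sum>j\<in>UNIV. \<Sum>m\<in>UNIV.
                 d_z j (d_zbar m (\<lambda>q. complex_of_real (\<Phi> q))) p
                   * (z $ j * cnj (w $ m) - w $ j * cnj (z $ m))))"

text \<open>
  An orthonormal basis of \<open>\<real>\<^sup>n\<close> is indexed by \<open>'n\<close> itself, and the set \<open>K\<close> of indices of the
  basis vectors that span \<open>ker B\<close> plays the role of \<open>{1, \<dots>, k}\<close>, so that \<open>- K\<close> plays the role
  of \<open>{k + 1, \<dots>, n}\<close> and \<open>card K = k = dim (ker B)\<close>. Accordingly, in \<open>\<theta> = (\<theta>', \<theta>'')\<close> the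
  components of \<open>\<theta>'\<close> sit at \<open>Inl j\<close> with \<open>j \<in> K\<close>, and those of \<open>\<theta>''\<close> (as for the functions
  \<open>t_dprime\<close> and \<open>f_dprime\<close>) at \<open>Inl j\<close> with \<open>j \<notin> K\<close> and at all \<open>Inr j\<close>; the values of
  these functions at \<open>Inl j\<close> with \<open>j \<in> K\<close> are never used.
\<close>

definition adapted_basis :: "real^'n^'n \<Rightarrow> 'n set \<Rightarrow> ('n \<Rightarrow> real^'n) \<Rightarrow> bool" where
  "adapted_basis B K b \<longleftrightarrow>
     (\<forall>i j. b i \<bullet> b j = (if i = j then 1 else 0)) \<and> span (b ` K) = {x. B *v x = 0}"

definition beta_vec ::
    "real^'n^'n \<Rightarrow> real^'n^'n \<Rightarrow> 'n set \<Rightarrow> ('n \<Rightarrow> real^'n) \<Rightarrow> 'n \<Rightarrow> real^'n" where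
  "beta_vec A B K b J = (THE v.
     (\<forall>j\<in>K. v \<bullet> (A *v b j) = 0) \<and>
     (\<forall>j\<in>- K - {J}. v \<bullet> (B *v b j) = 0) \<and>
     v \<bullet> (B *v b J) = 1)"

definition t_prime :: "real^'n^'n \<Rightarrow> ('n \<Rightarrow> real^'n) \<Rightarrow> complex^'n \<Rightarrow> 'n \<Rightarrow> real" where
  "t_prime D b z j = - (b j \<bullet> Re_vec z) + (D *v b j) \<bullet> Im_vec z"

definition t_dprime :: "real^'n^'n \<Rightarrow> real^'n^'n \<Rightarrow> 'n set \<Rightarrow> ('n \<Rightarrow> real^'n) \<Rightarrow>
    complex^'n \<Rightarrow> 'n + 'n \<Rightarrow> real" where
  "t_dprime A B K b z i = (case i of
       Inl j \<Rightarrow> - ((transpose A *v beta_vec A B K b j) \<bullet> Re_vec z) + beta_vec A B K b j \<bullet> Im_vec z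
     | Inr j \<Rightarrow> b j \<bullet> Re_vec z)"

definition f_dprime :: "real^'n^'n \<Rightarrow> real^'n^'n \<Rightarrow> real^'n^'n \<Rightarrow> real^'n^'n \<Rightarrow> 'n set \<Rightarrow>
    ('n \<Rightarrow> real^'n) \<Rightarrow> ('n + 'n \<Rightarrow> real) \<Rightarrow> 'n + 'n \<Rightarrow> real" where
  "f_dprime A B C D K b s p = (case p of
       Inl i \<Rightarrow> (\<Sum>j\<in>- K. ((B *v b i) \<bullet> (D *v b j)) * s (Inl j))
             + (\<Sum>j\<in>UNIV. ((B *v b i) \<bullet> (C *v b j)) * s (Inr j))
     | Inr i \<Rightarrow> (\<Sum>j\<in>- K. ((C *v b i) \<bullet> (B *v b j)) * s (Inl j))
             + (\<Sum>j\<in>UNIV. ((A *v b i) \<bullet> (C *v b j)) * s (Inr j)))"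

definition F_form :: "real^'n^'n \<Rightarrow> real^'n^'n \<Rightarrow> real^'n^'n \<Rightarrow> real^'n^'n \<Rightarrow> 'n set \<Rightarrow>
    ('n \<Rightarrow> real^'n) \<Rightarrow> ('n + 'n \<Rightarrow> real) \<Rightarrow> real" where
  "F_form A B C D K b s =
     1 / 2 * (\<Sum>i\<in>- K. \<Sum>j\<in>- K. s (Inl i) * ((B *v b i) \<bullet> (D *v b j)) * s (Inl j))
   + (\<Sum>i\<in>- K. \<Sum>j\<in>UNIV. s (Inl i) * ((B *v b i) \<bullet> (C *v b j)) * s (Inr j))
   + 1 / 2 * (\<Sum>i\<in>UNIV. \<Sum>j\<in>UNIV. s (Inr i) * ((A *v b i) \<bullet> (C *v b j)) * s (Inr j))"

definition explicit_form :: "real^'n^'n \<Rightarrow> real^'n^'n \<Rightarrow> real^'n^'n \<Rightarrow> real^'n^'n \<Rightarrow> 'n set \<Rightarrow>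
    ('n \<Rightarrow> real^'n) \<Rightarrow> (complex^'n) \<times> (real^('n::finite + 'n)) \<Rightarrow> real" where
  "explicit_form A B C D K b = (\<lambda>(z, \<theta>).
     (\<Sum>j\<in>K. \<theta> $ Inl j * t_prime D b z j)
   + F_form A B C D K b (t_dprime A B K b z)
   + (\<Sum>i\<in>- (Inl ` K). (\<theta> $ i - f_dprime A B C D K b (t_dprime A B K b z) i)\<^sup>2))"

end

theory Submission
  imports Defs
begin

text \<open>
  The two claims about \<open>\<Phi>\<close> have independent reasons.

  The formula for the symplectic form holds for every real quadratic form \<open>\<Phi>\<close>. The
  derivative \<open>\<partial>\<Phi>/\<partial>z\<^sub>j\<close> is real-linear, so it is a combination of \<open>z\<close>, its conjugate and \<open>\<theta>\<close> whose coefficients are the second derivatives.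
  Substituting this into the symplectic form, the \<open>\<partial>\<^sup>2\<Phi>/\<partial>z\<^sub>j\<partial>z\<^sub>m\<close> part cancels because it is symmetric
  in \<open>j\<close> and \<open>m\<close>, and the other two parts are the right-hand side (\<open>omega_formula_quadratic_form\<close>).

  For the graph, write \<open>z = x + iy\<close>. A point of the graph is given by a pair \<open>(x, \<xi>)\<close> with
  \<open>y = Ax + B\<xi>\<close>. The symplectic relations make \<open>Ab\<^sub>j\<close> (\<open>j \<in> K\<close>) together with \<open>Bb\<^sub>j\<close>
  (\<open>j \<notin> K\<close>) a basis with dual basis \<open>Db\<^sub>j\<close> (\<open>j \<in> K\<close>), \<open>\<beta>\<^sub>j\<close> (\<open>j \<notin> K\<close>). In these terms
  \<open>t'\<^sub>j\<close> (\<open>j \<in> K\<close>) and \<open>t''\<^sub>j\<close> (\<open>j \<notin> K\<close>) are the coordinates of \<open>y - Ax\<close>. Hence \<open>t' = 0\<close> says exactly that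
  \<open>y - Ax\<close> lies in the range of \<open>B\<close>, and then \<open>t''\<close> gives the component of \<open>\<xi>\<close> orthogonal to
  \<open>ker B\<close> (\<open>residual_expansion\<close>). The component of \<open>\<xi>\<close> in \<open>ker B\<close> is not determined by \<open>z\<close>: this is
  what the multipliers \<open>\<theta>'\<close> parametrize, up to a shift depending on \<open>z\<close>. The equations
  \<open>\<partial>\<Phi>/\<partial>\<theta> = 0\<close> say that \<open>t' = 0\<close> and \<open>\<theta>'' = f''\<close> (\<open>critical_iff\<close>); the squares only eliminate
  \<open>\<theta>''\<close> and do not contribute to the gradient at critical points. The symplectic relations
  then reduce the \<open>z\<close>-gradient there to \<open>w \<bullet> (Cx + D\<xi>) - u \<bullet> \<xi>\<close> in the direction \<open>u + iw\<close>
  (\<open>F_along_line\<close>, \<open>grad_z_critical\<close>), which amounts to \<open>-2 \<partial>\<Phi>/\<partial>z = \<xi> + i(Cx + D\<xi>)\<close>.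
\<close>

section \<open>Quadratic forms and the symplectic form on their gradients\<close>

text \<open>
  All functions to be differentiated are polynomials of degree at most two along every line, so a
  directional derivative is the coefficient of \<open>t\<close> in an algebraic expansion.
\<close>

lemma deriv_along_quadratic:
  assumes "\<And>t. f (p + t *\<^sub>R v) = a + t *\<^sub>R l + t\<^sup>2 *\<^sub>R m"
  shows "deriv_along v f p = l"
proof -
  have "((\<lambda>t. a + t *\<^sub>R l + t\<^sup>2 *\<^sub>R m) has_vector_derivative l) (at 0)"
    by (auto intro!: derivative_eq_intros)
  then show ?thesis
    unfolding deriv_along_def assms by (rule vector_derivative_at)
qed

lemma deriv_along_linear:
  assumes "linear f"
  shows "deriv_along v f p = f v"
  by (rule deriv_along_quadratic[where a = "f p" and m = 0])
    (simp add: linear_add[OF assms] linear_scale[OF assms])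

lemma quadratic_form_line:
  fixes \<beta> :: "'v::real_vector \<Rightarrow> 'v \<Rightarrow> real"
  assumes "bilinear \<beta>"
  shows "\<beta> (p + t *\<^sub>R v) (p + t *\<^sub>R v) = \<beta> p p + t * (\<beta> v p + \<beta> p v) + t\<^sup>2 * \<beta> v v"
  by (simp add: bilinear_ladd[OF assms] bilinear_radd[OF assms] bilinear_lmul[OF assms]
      bilinear_rmul[OF assms] algebra_simps power2_eq_square)

lemma deriv_along_quadratic_form:
  assumes "bilinear \<beta>" and "\<And>x. Q x = \<beta> x x"
  shows "deriv_along v Q p = \<beta> v p + \<beta> p v"
    and "deriv_along v (\<lambda>q. complex_of_real (Q q)) p = complex_of_real (\<beta> v p + \<beta> p v)"
proof -
  show "deriv_along v Q p = \<beta> v p + \<beta> p v"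
    by (rule deriv_along_quadratic[where a = "\<beta> p p" and m = "\<beta> v v"])
      (simp add: assms(2) quadratic_form_line[OF assms(1)])
  show "deriv_along v (\<lambda>q. complex_of_real (Q q)) p = complex_of_real (\<beta> v p + \<beta> p v)"
    by (rule deriv_along_quadratic[where a = "complex_of_real (\<beta> p p)" and m = "complex_of_real (\<beta> v v)"])
      (simp add: assms(2) quadratic_form_line[OF assms(1)] scaleR_conv_of_real)
qed

lemma deriv_along_of_real_quadratic_form:
  assumes "quadratic_form Q"
  shows "deriv_along v (\<lambda>q. complex_of_real (Q q)) p = complex_of_real (deriv_along v Q p)"
proof -
  obtain \<beta> where "bilinear \<beta>" "\<And>x. Q x = \<beta> x x"
    using assms unfolding quadratic_form_def by blast
  then show ?thesis
    by (simp only: deriv_along_quadratic_form)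
qed

lemma linear_Re_vec: "linear Re_vec" and linear_Im_vec: "linear Im_vec"
  by (auto simp: linear_iff Re_vec_def Im_vec_def vec_eq_iff)

lemma complex_vec_simps [simp]:
  "Re_vec (complex_vec x y) = x" "Im_vec (complex_vec x y) = y"
  "complex_vec (Re_vec z) (Im_vec z) = z"
  by (simp_all add: Re_vec_def Im_vec_def complex_vec_def vec_eq_iff)

lemma complex_vec_real_expansion:
  "z = (\<Sum>m\<in>UNIV. Re (z $ m) *\<^sub>R axis m 1 + Im (z $ m) *\<^sub>R axis m \<i>)"
  unfolding vec_eq_iff sum_component vector_add_component vector_scaleR_component
  by (auto simp: axis_def if_distrib sum.delta sum.distrib complex_eq_iff cong: if_cong)

lemma real_vec_expansion: "\<theta> = (\<Sum>l\<in>UNIV. \<theta> $ l *\<^sub>R axis l (1::real))"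
  unfolding vec_eq_iff sum_component vector_add_component vector_scaleR_component
  by (auto simp: axis_def if_distrib sum.delta cong: if_cong)

text \<open>
  The coefficients of a real-linear function in \<open>z\<close> and its conjugate are its Wirtinger
  derivatives. Applied to \<open>\<partial>\<Phi>/\<partial>z\<^sub>j\<close>, this expands the gradient in second derivatives of \<open>\<Phi>\<close>.
\<close>

lemma linear_expansion_z_theta:
  fixes L :: "(complex^'n) \<times> (real^'m) \<Rightarrow> complex"
  assumes "linear L"
  shows "L (z, \<theta>) =
    (\<Sum>m\<in>UNIV. (L (axis m 1, 0) - \<i> * L (axis m \<i>, 0)) / 2 * z $ m)
    + (\<Sum>m\<in>UNIV. (L (axis m 1, 0) + \<i> * L (axis m \<i>, 0)) / 2 * cnj (z $ m))
    + (\<Sum>l\<in>UNIV. L (0, axis l 1) * complex_of_real (\<theta> $ l))"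
proof -
  have lz: "linear (\<lambda>z. L (z, 0))" and lt: "linear (\<lambda>\<theta>. L (0, \<theta>))"
    by (rule linear_compose[OF _ assms, unfolded o_def], rule linearI, auto)+
  have "L (z, \<theta>) = L (z, 0) + L (0, \<theta>)"
    by (simp add: linear_add[OF assms, symmetric])
  moreover have "L (z, 0) = (\<Sum>m\<in>UNIV. Re (z $ m) *\<^sub>R L (axis m 1, 0) + Im (z $ m) *\<^sub>R L (axis m \<i>, 0))"
    by (subst complex_vec_real_expansion[of z])
      (simp only: linear_sum[OF lz] linear_add[OF lz] linear_scale[OF lz])
  moreover have "Re (z $ m) *\<^sub>R L (axis m 1, 0) + Im (z $ m) *\<^sub>R L (axis m \<i>, 0)
      = (L (axis m 1, 0) - \<i> * L (axis m \<i>, 0)) / 2 * z $ m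
        + (L (axis m 1, 0) + \<i> * L (axis m \<i>, 0)) / 2 * cnj (z $ m)" for m
    by (simp add: complex_eq_iff field_simps)
  moreover have "L (0, \<theta>) = (\<Sum>l\<in>UNIV. L (0, axis l 1) * complex_of_real (\<theta> $ l))"
    by (subst real_vec_expansion[of \<theta>])
      (simp only: linear_sum[OF lt] linear_scale[OF lt], simp add: scaleR_conv_of_real mult.commute)
  ultimately show ?thesis
    by (simp add: sum.distrib)
qed

lemma sum_symmetric_antisymmetric:
  fixes N :: "'n::finite \<Rightarrow> 'n \<Rightarrow> complex"
  assumes "\<And>j m. N j m = N m j"
  shows "(\<Sum>j\<in>UNIV. \<Sum>m\<in>UNIV. N j m * (z j * w m - w j * z m)) = 0"
proof -
  have "(\<Sum>j\<in>UNIV. \<Sum>m\<in>UNIV. N j m * (w j * z m)) = (\<Sum>j\<in>UNIV. \<Sum>m\<in>UNIV. N j m * (z j * w m))"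
    by (subst sum.swap) (simp add: assms mult.commute mult.left_commute cong: sum.cong)
  then show ?thesis
    by (simp add: right_diff_distrib sum_subtractf)
qed

text \<open>
  The first derivatives of \<open>\<Phi>\<close> are given by the polar form of \<open>\<Phi>\<close>, whose symmetry is the symmetry
  of second derivatives.
\<close>

lemma omega_formula_quadratic_form:
  fixes \<Phi> :: "(complex^'n) \<times> (real^('n::finite + 'n)) \<Rightarrow> real"
  assumes "quadratic_form \<Phi>"
  shows "omega_formula \<Phi>"
proof -
  obtain \<beta> where \<beta>: "bilinear \<beta>" "\<And>x. \<Phi> x = \<beta> x x"
    using assms unfolding quadratic_form_def by blast
  define S where "S v p = complex_of_real (\<beta> v p + \<beta> p v)" for v p
  have S_sym: "S v p = S p v" for v p
    by (simp add: S_def add.commute)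
  have S_lin: "linear (S v)" for v
    by (rule linearI)
      (simp_all add: S_def bilinear_ladd[OF \<beta>(1)] bilinear_radd[OF \<beta>(1)] bilinear_lmul[OF \<beta>(1)]
        bilinear_rmul[OF \<beta>(1)] scaleR_conv_of_real algebra_simps)
  have d1: "deriv_along v (\<lambda>q. complex_of_real (\<Phi> q)) = S v" for v
    by (rule ext) (simp only: deriv_along_quadratic_form(2)[OF \<beta>] S_def)
  define L where "L j q = (S (axis j 1, 0) q - \<i> * S (axis j \<i>, 0) q) / 2" for j q
  have L_lin: "linear (L j)" for j
    by (rule linearI)
      (simp_all add: L_def linear_add[OF S_lin] linear_scale[OF S_lin] scaleR_conv_of_real field_simps)
  have grad: "grad_z \<Phi> p $ j = L j p" for p j
    by (simp add: grad_z_def d_z_def d1 L_def)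
  have d_zt: "d_z j (d_theta l (\<lambda>q. complex_of_real (\<Phi> q))) p = L j (0, axis l 1)" for j l p
  proof -
    have "d_theta l (\<lambda>q. complex_of_real (\<Phi> q)) = S (0, axis l 1)"
      by (rule ext) (simp add: d_theta_def d1)
    then show ?thesis
      by (simp add: d_z_def deriv_along_linear[OF S_lin] L_def S_sym)
  qed
  have d_zz: "d_z j (d_zbar m (\<lambda>q. complex_of_real (\<Phi> q))) p
      = (L j (axis m 1, 0) + \<i> * L j (axis m \<i>, 0)) / 2" for j m p
  proof -
    let ?G = "\<lambda>q. (S (axis m 1, 0) q + \<i> * S (axis m \<i>, 0) q) / 2"
    have "d_zbar m (\<lambda>q. complex_of_real (\<Phi> q)) = ?G"
      by (rule ext) (simp add: d_zbar_def d1)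
    moreover have "linear ?G"
      by (rule linearI)
        (simp_all add: linear_add[OF S_lin] linear_scale[OF S_lin] scaleR_conv_of_real field_simps)
    ultimately show ?thesis
      using S_sym[of "(axis m 1, 0)" "(axis j 1, 0)"] S_sym[of "(axis m 1, 0)" "(axis j \<i>, 0)"]
        S_sym[of "(axis m \<i>, 0)" "(axis j 1, 0)"] S_sym[of "(axis m \<i>, 0)" "(axis j \<i>, 0)"]
      by (simp add: d_z_def deriv_along_linear L_def field_simps)
  qed
  \<comment> \<open>\<open>N\<close>, \<open>M\<close> and \<open>T\<close> are the second derivatives in \<open>z z\<close>, in \<open>z\<close> and the conjugate of \<open>z\<close>,
    and in \<open>z \<theta>\<close>.\<close>
  define N where "N j m = (L j (axis m 1, 0) - \<i> * L j (axis m \<i>, 0)) / 2" for j m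
  define M where "M j m = (L j (axis m 1, 0) + \<i> * L j (axis m \<i>, 0)) / 2" for j m
  have N_sym: "N j m = N m j" for j m
    using S_sym[of "(axis m 1, 0)" "(axis j 1, 0)"] S_sym[of "(axis m 1, 0)" "(axis j \<i>, 0)"]
      S_sym[of "(axis m \<i>, 0)" "(axis j 1, 0)"] S_sym[of "(axis m \<i>, 0)" "(axis j \<i>, 0)"]
    by (simp add: N_def L_def field_simps)
  define T where "T j l = L j (0, axis l 1)" for j l
  have L_exp: "L j (z, \<theta>) = (\<Sum>m\<in>UNIV. N j m * z $ m) + (\<Sum>m\<in>UNIV. M j m * cnj (z $ m))
      + (\<Sum>l\<in>UNIV. T j l * complex_of_real (\<theta> $ l))" for j z \<theta>
    using linear_expansion_z_theta[OF L_lin] unfolding N_def M_def T_def .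
  have "omegaC (z, - 2 *\<^sub>R grad_z \<Phi> (z, \<theta>)) (w, - 2 *\<^sub>R grad_z \<Phi> (w, \<eta>)) =
          2 * (\<Sum>j\<in>UNIV. \<Sum>l\<in>UNIV. T j l
                   * (z $ j * complex_of_real (\<eta> $ l) - w $ j * complex_of_real (\<theta> $ l)))
        + 2 * (\<Sum>j\<in>UNIV. \<Sum>m\<in>UNIV. M j m * (z $ j * cnj (w $ m) - w $ j * cnj (z $ m)))"
    (is "_ = 2 * ?T + 2 * ?M") for z w \<theta> \<eta>
  proof -
    have "omegaC (z, - 2 *\<^sub>R grad_z \<Phi> (z, \<theta>)) (w, - 2 *\<^sub>R grad_z \<Phi> (w, \<eta>))
        = (\<Sum>j\<in>UNIV. 2 * (z $ j * L j (w, \<eta>) - w $ j * L j (z, \<theta>)))"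
      by (simp add: omegaC_def grad scaleR_conv_of_real algebra_simps cong: sum.cong)
    also have "\<dots> = 2 * (\<Sum>j\<in>UNIV. z $ j * L j (w, \<eta>) - w $ j * L j (z, \<theta>))"
      by (simp only: sum_distrib_left)
    also have "(\<Sum>j\<in>UNIV. z $ j * L j (w, \<eta>) - w $ j * L j (z, \<theta>)) =
        (\<Sum>j\<in>UNIV. \<Sum>m\<in>UNIV. N j m * (z $ j * w $ m - w $ j * z $ m)) + ?M + ?T"
      unfolding L_exp
      by (simp add: sum_distrib_left sum_subtractf sum.distrib algebra_simps)
    finally show ?thesis
      unfolding sum_symmetric_antisymmetric[OF N_sym] by (simp add: distrib_left)
  qed
  then show ?thesis
    unfolding omega_formula_def d_zt d_zz M_def[symmetric] T_def[symmetric] by blast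
qed

lemma quadratic_form_mult:
  assumes "linear f" "linear g"
  shows "quadratic_form (\<lambda>x. f x * g x)"
  unfolding quadratic_form_def
  by (rule exI[of _ "\<lambda>x y. f x * g y"])
    (auto simp: bilinear_def linear_add[OF assms(1)] linear_scale[OF assms(1)]
      linear_add[OF assms(2)] linear_scale[OF assms(2)] algebra_simps intro!: linearI)

lemma quadratic_form_add:
  assumes "quadratic_form f" "quadratic_form g"
  shows "quadratic_form (\<lambda>x. f x + g x)"
proof -
  obtain \<beta> \<gamma> where "bilinear \<beta>" "\<forall>x. f x = \<beta> x x" "bilinear \<gamma>" "\<forall>x. g x = \<gamma> x x"
    using assms unfolding quadratic_form_def by blast
  then show ?thesis
    unfolding quadratic_form_def
    by (intro exI[of _ "\<lambda>x y. \<beta> x y + \<gamma> x y"])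
      (auto simp: bilinear_def intro: linear_compose_add)
qed

lemma quadratic_form_cmult:
  assumes "quadratic_form f"
  shows "quadratic_form (\<lambda>x. c * f x)"
proof -
  obtain \<beta> where "bilinear \<beta>" "\<forall>x. f x = \<beta> x x"
    using assms unfolding quadratic_form_def by blast
  then show ?thesis
    unfolding quadratic_form_def
    by (intro exI[of _ "\<lambda>x y. c * \<beta> x y"])
      (auto simp: bilinear_def linear_iff distrib_left mult.left_commute)
qed

lemma quadratic_form_sum:
  assumes "\<And>i. i \<in> I \<Longrightarrow> quadratic_form (f i)"
  shows "quadratic_form (\<lambda>x. \<Sum>i\<in>I. f i x)"
proof -
  have zero: "quadratic_form (\<lambda>x. 0)"
    using quadratic_form_mult[OF linear_zero linear_zero] by simp
  show ?thesis
    using assms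
    by (induction I rule: infinite_finite_induct) (auto intro: zero quadratic_form_add)
qed

section \<open>Symplectic block matrices\<close>

text \<open>
  The block relations \<open>A\<^sup>TC = C\<^sup>TA\<close>, \<open>B\<^sup>TD = D\<^sup>TB\<close> and \<open>A\<^sup>TD - C\<^sup>TB = I\<close>, in the bilinear shape in
  which they are used to move matrices across inner products.
\<close>

locale symplectic_blocks =
  fixes A B C D :: "real^'n::finite^'n"
  assumes AC: "(A *v u) \<bullet> (C *v v) = (C *v u) \<bullet> (A *v v)"
    and BD: "(B *v u) \<bullet> (D *v v) = (D *v u) \<bullet> (B *v v)"
    and AD: "(A *v u) \<bullet> (D *v v) = u \<bullet> v + (C *v u) \<bullet> (B *v v)"

definition block_vec :: "real^'n \<Rightarrow> real^'n \<Rightarrow> real^('n::finite + 'n)" where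
  "block_vec u v = (\<chi> p. case p of Inl i \<Rightarrow> u $ i | Inr i \<Rightarrow> v $ i)"

lemma sum_UNIV_Plus:
  fixes f :: "'a::finite + 'b::finite \<Rightarrow> 'c::comm_monoid_add"
  shows "sum f UNIV = (\<Sum>i\<in>UNIV. f (Inl i)) + (\<Sum>i\<in>UNIV. f (Inr i))"
  using sum.Plus[of "UNIV :: 'a set" "UNIV :: 'b set" f] by (simp add: o_def)

lemma block_matrix_vec:
  "block_matrix A B C D *v block_vec u v = block_vec (A *v u + B *v v) (C *v u + D *v v)"
  by (simp add: vec_eq_iff block_matrix_def block_vec_def matrix_vector_mult_def sum_UNIV_Plus
      split: sum.split)

lemma inner_block_vec: "block_vec u v \<bullet> block_vec u' v' = u \<bullet> u' + v \<bullet> v'"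
  by (simp add: inner_vec_def block_vec_def sum_UNIV_Plus)

text \<open>
  The matrix equation says that \<open>H\<close> preserves the bilinear form of \<open>J\<close>; the block relations result
  from evaluating it on pairs of vectors with one vanishing block each.
\<close>

lemma symplectic_blocksI:
  assumes "block_matrix A B C D \<in> Sp"
  shows "symplectic_blocks A B C D"
proof -
  let ?H = "block_matrix A B C D"
  let ?J = "symplectic_J :: real^('a + 'a)^('a + 'a)"
  have "- mat 1 *v v = - v" for v :: "real^'a"
    using matrix_vector_mult_diff_rdistrib[of 0 "mat 1" v] by simp
  then have J: "?J *v block_vec u v = block_vec (- v) u" for u v
    by (simp add: symplectic_J_def block_matrix_vec)
  have H: "(?H *v p) \<bullet> (?J *v (?H *v q)) = p \<bullet> (?J *v q)" for p q
  proof -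
    have "(?H *v p) \<bullet> (?J *v (?H *v q)) = p \<bullet> (transpose ?H *v (?J *v (?H *v q)))"
      by (metis dot_lmul_matrix inner_commute transpose_matrix_vector)
    also have "\<dots> = p \<bullet> ((transpose ?H ** ?J ** ?H) *v q)"
      by (simp only: matrix_vector_mul_assoc matrix_mul_assoc)
    finally show ?thesis
      using assms by (simp add: Sp_def)
  qed
  have *: "(C *v u + D *v v) \<bullet> (A *v u' + B *v v') - (A *v u + B *v v) \<bullet> (C *v u' + D *v v')
      = v \<bullet> u' - u \<bullet> v'" for u v u' v'
    using H[of "block_vec u v" "block_vec u' v'"]
    by (simp add: J block_matrix_vec inner_block_vec inner_diff_right inner_add_right)
  show ?thesis
  proof
    fix u v
    show "(A *v u) \<bullet> (C *v v) = (C *v u) \<bullet> (A *v v)"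
      using *[of u 0 v 0] by (simp add: matrix_vector_mult_0_right)
    show "(B *v u) \<bullet> (D *v v) = (D *v u) \<bullet> (B *v v)"
      using *[of 0 u 0 v] by (simp add: matrix_vector_mult_0_right)
    show "(A *v u) \<bullet> (D *v v) = u \<bullet> v + (C *v u) \<bullet> (B *v v)"
      using *[of u 0 0 v] by (simp add: matrix_vector_mult_0_right)
  qed
qed

section \<open>Adapted bases\<close>

lemma orthonormal_family_expansion:
  fixes b :: "'n::finite \<Rightarrow> real^'n"
  assumes "\<And>i j. b i \<bullet> b j = (if i = j then 1 else 0)"
  shows "x = (\<Sum>j\<in>UNIV. (b j \<bullet> x) *\<^sub>R b j)"
proof -
  define M where "M = (\<chi> i. b i)"
  have "M ** transpose M = mat 1"
    using assms by (simp add: vec_eq_iff M_def matrix_matrix_mult_def transpose_def mat_def inner_vec_def)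
  then have "transpose M ** M = mat 1"
    by (simp add: matrix_left_right_inverse)
  then have "x = transpose M *v (M *v x)"
    by (metis matrix_vector_mul_assoc matrix_vector_mul_lid)
  also have "\<dots> = (\<Sum>j\<in>UNIV. (b j \<bullet> x) *\<^sub>R b j)"
    by (simp add: vec_eq_iff M_def matrix_vector_mult_def transpose_def inner_vec_def mult.commute)
  finally show ?thesis .
qed

text \<open>
  Join orthonormal bases of \<open>ker B\<close> and of its orthogonal complement and number the result by the
  index type.
\<close>

lemma adapted_basis_exists:
  fixes B :: "real^'n::finite^'n"
  obtains K b where "adapted_basis B K b"
proof -
  define S where "S = {x. B *v x = 0}"
  have S: "subspace S"
    by (auto simp: S_def subspace_def matrix_vector_right_distrib matrix_vector_mult_scaleR)
  obtain X where X: "X \<subseteq> S" "pairwise orthogonal X" "\<And>x. x \<in> X \<Longrightarrow> norm x = 1" "span X = S"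
    by (rule orthonormal_basis_subspace[OF S]) (rule that)
  define T where "T = {x. \<forall>y\<in>S. orthogonal y x}"
  have T: "subspace T"
    by (auto simp: T_def subspace_def orthogonal_clauses)
  obtain Y where Y: "Y \<subseteq> T" "pairwise orthogonal Y" "\<And>x. x \<in> Y \<Longrightarrow> norm x = 1" "span Y = T"
    by (rule orthonormal_basis_subspace[OF T]) (rule that)
  have "orthogonal x y \<and> orthogonal y x" if "x \<in> X" "y \<in> Y" for x y
    using subsetD[OF X(1) that(1)] subsetD[OF Y(1) that(2)] by (simp add: T_def orthogonal_commute)
  then have orth: "pairwise orthogonal (X \<union> Y)"
    using X(2) Y(2) by (simp add: pairwise_def ball_Un)
  have norm1: "norm x = 1" if "x \<in> X \<union> Y" for x
    using that X(3) Y(3) by auto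
  then have ind: "independent (X \<union> Y)"
    by (intro pairwise_orthogonal_independent orth notI) (metis norm_zero zero_neq_one)
  have "x \<in> span (X \<union> Y)" for x
  proof -
    obtain y z where yz: "y \<in> span S" "\<And>w. w \<in> span S \<Longrightarrow> orthogonal z w" "x = y + z"
      by (rule orthogonal_subspace_decomp_exists[of S x]) (rule that)
    have "y \<in> span X"
      using yz(1) S X(4) by (simp add: span_eq_iff[THEN iffD2])
    moreover have "z \<in> span Y"
      unfolding Y(4) T_def using yz(2) by (simp add: orthogonal_commute span_base)
    ultimately show ?thesis
      unfolding yz(3)
      using span_mono[of X "X \<union> Y"] span_mono[of Y "X \<union> Y"] by (intro span_add) auto
  qed
  then have "span (X \<union> Y) = span UNIV"
    by auto
  from dim_eq_card[OF this ind] have "card (X \<union> Y) = card (UNIV :: 'n set)"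
    by simp
  moreover have "finite (X \<union> Y)"
    using ind by (rule independent_imp_finite)
  ultimately obtain b where b: "bij_betw b (UNIV :: 'n set) (X \<union> Y)"
    using finite_same_card_bij[of "UNIV :: 'n set" "X \<union> Y"] by auto
  have "b i \<bullet> b j = (if i = j then 1 else 0)" for i j
  proof -
    have "b i \<in> X \<union> Y" "b j \<in> X \<union> Y" "b i = b j \<Longrightarrow> i = j"
      using b by (auto simp: bij_betw_def inj_on_def)
    then show ?thesis
      using orth norm1 by (auto simp: pairwise_def orthogonal_def norm_eq_1)
  qed
  moreover have "b ` {j. b j \<in> X} = X"
    using b by (auto simp: bij_betw_def)
  ultimately have "adapted_basis B {j. b j \<in> X} b"
    using X(4) by (simp add: adapted_basis_def S_def)
  then show ?thesis
    by (rule that)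
qed

section \<open>The dual frame of a symplectic matrix\<close>

locale adapted_blocks = symplectic_blocks A B C D
  for A B C D :: "real^'n::finite^'n" +
  fixes K :: "'n set" and b :: "'n \<Rightarrow> real^'n"
  assumes adapted: "adapted_basis B K b"
begin

lemma b_inner: "b i \<bullet> b j = (if i = j then 1 else 0)"
  using adapted by (simp add: adapted_basis_def)

lemma b_expansion: "x = (\<Sum>j\<in>UNIV. (b j \<bullet> x) *\<^sub>R b j)"
  by (rule orthonormal_family_expansion[where b = b]) (rule b_inner)

lemma B_b [simp]: "j \<in> K \<Longrightarrow> B *v b j = 0"
  using adapted span_base[of "b j" "b ` K"] by (simp add: adapted_basis_def)

lemma ker_orthogonal:
  assumes "B *v x = 0" "j \<notin> K"
  shows "b j \<bullet> x = 0"
proof -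
  have "x \<in> span (b ` K)"
    using assms adapted by (simp add: adapted_basis_def)
  then have "orthogonal (b j) x"
    by (rule orthogonal_to_span) (use assms(2) in \<open>auto simp: orthogonal_def b_inner\<close>)
  then show ?thesis
    by (simp add: orthogonal_def)
qed

lemma sum_K_compl: "(\<Sum>j\<in>UNIV. f j) = (\<Sum>j\<in>K. f j) + (\<Sum>j\<in>- K. f j)"
  for f :: "'n \<Rightarrow> 'c::comm_monoid_add"
  using sum.subset_diff[of K UNIV f] by (simp add: Compl_eq_Diff_UNIV add.commute)

lemma ker_expansion:
  assumes "B *v x = 0"
  shows "x = (\<Sum>j\<in>K. (b j \<bullet> x) *\<^sub>R b j)"
proof -
  have "(\<Sum>j\<in>UNIV. (b j \<bullet> x) *\<^sub>R b j) = (\<Sum>j\<in>K. (b j \<bullet> x) *\<^sub>R b j)"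
    by (simp add: sum_K_compl ker_orthogonal[OF assms])
  then show ?thesis
    by (rule b_expansion[of x, THEN trans])
qed

text \<open>
  On \<open>ker B\<close> the block relations lose their \<open>B\<close> terms: there \<open>A\<^sup>TD\<close> is the identity and \<open>B\<^sup>TD\<close>
  vanishes. So the vectors \<open>Db\<^sub>j\<close> with \<open>j \<in> K\<close> are orthogonal to the range of \<open>B\<close>
  and dual to the \<open>Ab\<^sub>j\<close> with \<open>j \<in> K\<close>.
\<close>

lemma Db_A: "j \<in> K \<Longrightarrow> (D *v b j) \<bullet> (A *v u) = b j \<bullet> u"
  using AD[of u "b j"] by (simp add: inner_commute)

lemma Db_B: "j \<in> K \<Longrightarrow> (D *v b j) \<bullet> (B *v u) = 0"
  using BD[of "b j" u] by simp

lemma mult_sum: "M *v (\<Sum>i\<in>I. c i *\<^sub>R v i) = (\<Sum>i\<in>I. c i *\<^sub>R (M *v v i))" for M :: "real^'n^'n"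
  by (simp add: linear_sum[OF matrix_vector_mul_linear] matrix_vector_mult_scaleR)

definition frame :: "'n \<Rightarrow> real^'n" where
  "frame j = (if j \<in> K then A *v b j else B *v b j)"

text \<open>
  The frame is independent: pairing a vanishing combination with \<open>Db\<^sub>i\<close> kills the coefficients in
  \<open>K\<close>; the rest then lies in \<open>ker B\<close> and in its orthogonal complement. The dual vectors are the
  rows of the inverse of the matrix that has the frame as its columns.
\<close>

lemma frame_expansion: "\<exists>a. g = (\<Sum>j\<in>UNIV. a j *\<^sub>R frame j)"
  and dual_vector_exists: "\<exists>v. \<forall>j. v \<bullet> frame j = (if j = J then 1 else 0)"
proof -
  define E where "E = transpose (\<chi> j. frame j)"
  have E: "E *v a = (\<Sum>j\<in>UNIV. a $ j *\<^sub>R frame j)" for a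
    by (simp add: vec_eq_iff E_def matrix_vector_mult_def transpose_def mult.commute)
  have "a = 0" if "E *v a = 0" for a
  proof -
    have eq: "(\<Sum>j\<in>K. a $ j *\<^sub>R (A *v b j)) + (\<Sum>j\<in>- K. a $ j *\<^sub>R (B *v b j)) = 0"
      using that by (simp add: E sum_K_compl frame_def)
    have aK: "a $ i = 0" if "i \<in> K" for i
    proof -
      have "(D *v b i) \<bullet> ((\<Sum>j\<in>K. a $ j *\<^sub>R (A *v b j)) + (\<Sum>j\<in>- K. a $ j *\<^sub>R (B *v b j))) = a $ i"
        using that by (simp add: inner_add_right inner_sum_right Db_A Db_B b_inner if_distrib
            sum.delta cong: if_cong)
      then show ?thesis
        by (simp add: eq)
    qed
    then have "B *v (\<Sum>j\<in>- K. a $ j *\<^sub>R b j) = 0"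
      using eq by (simp add: mult_sum)
    then have "b i \<bullet> (\<Sum>j\<in>- K. a $ j *\<^sub>R b j) = 0" if "i \<notin> K" for i
      using that by (rule ker_orthogonal)
    then have "a $ i = 0" if "i \<notin> K" for i
      using that by (force simp: inner_sum_right b_inner if_distrib sum.delta cong: if_cong)
    with aK show ?thesis
      by (auto simp: vec_eq_iff)
  qed
  then obtain E' where E': "E' ** E = mat 1"
    using matrix_left_invertible_ker[of E] by blast
  then have E'': "E ** E' = mat 1"
    by (simp add: matrix_left_right_inverse)
  then have "g = E *v (E' *v g)"
    by (simp add: matrix_vector_mul_assoc)
  then show "\<exists>a. g = (\<Sum>j\<in>UNIV. a j *\<^sub>R frame j)"
    unfolding E by blast
  have "(\<chi> i. E' $ J $ i) \<bullet> frame j = (E' ** E) $ J $ j" for j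
    by (simp add: matrix_matrix_mult_def E_def transpose_def inner_vec_def)
  then show "\<exists>v. \<forall>j. v \<bullet> frame j = (if j = J then 1 else 0)"
    unfolding E' by (intro exI[of _ "\<chi> i. E' $ J $ i"]) (auto simp: mat_def)
qed

abbreviation \<beta> :: "'n \<Rightarrow> real^'n" where
  "\<beta> \<equiv> beta_vec A B K b"

lemma \<beta>_frame:
  assumes "J \<notin> K"
  shows "\<beta> J \<bullet> frame j = (if j = J then 1 else 0)"
proof -
  have char: "((\<forall>j\<in>K. v \<bullet> (A *v b j) = 0) \<and> (\<forall>j\<in>- K - {J}. v \<bullet> (B *v b j) = 0) \<and> v \<bullet> (B *v b J) = 1)
      \<longleftrightarrow> (\<forall>j. v \<bullet> frame j = (if j = J then 1 else 0))" for v
    using assms by (auto simp: frame_def)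
  have unique: "v = w"
    if "\<forall>j. v \<bullet> frame j = (if j = J then 1 else 0)" "\<forall>j. w \<bullet> frame j = (if j = J then 1 else 0)" for v w
  proof -
    obtain a where a: "v - w = (\<Sum>j\<in>UNIV. a j *\<^sub>R frame j)"
      using frame_expansion by blast
    have "(v - w) \<bullet> frame j = 0" for j
      using that by (simp add: inner_diff_left)
    then have "(v - w) \<bullet> (\<Sum>j\<in>UNIV. a j *\<^sub>R frame j) = 0"
      by (simp add: inner_sum_right)
    then show ?thesis
      unfolding a[symmetric] by simp
  qed
  have "\<exists>!v. \<forall>j. v \<bullet> frame j = (if j = J then 1 else 0)"
    using dual_vector_exists unique by blast
  from theI'[OF this] show ?thesis
    unfolding beta_vec_def char by blast
qed

text \<open>
  This separates the obstruction to lying in the range of \<open>B\<close>, the pairings with the \<open>Db\<^sub>j\<close>, from the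
  remaining part, for which it exhibits a preimage under \<open>B\<close> orthogonal to \<open>ker B\<close>.
\<close>

lemma dual_frame_expansion:
  "g = (\<Sum>j\<in>K. ((D *v b j) \<bullet> g) *\<^sub>R (A *v b j)) + B *v (\<Sum>j\<in>- K. (\<beta> j \<bullet> g) *\<^sub>R b j)"
proof -
  obtain a where a: "g = (\<Sum>j\<in>UNIV. a j *\<^sub>R frame j)"
    using frame_expansion by blast
  have D_frame: "(D *v b i) \<bullet> frame j = (if j = i then 1 else 0)" if "i \<in> K" for i j
    using that by (simp add: frame_def Db_A Db_B b_inner)
  have D: "(D *v b i) \<bullet> g = a i" if "i \<in> K" for i
    unfolding a by (simp add: inner_sum_right D_frame[OF that] if_distrib sum.delta cong: if_cong)
  have \<beta>: "\<beta> i \<bullet> g = a i" if "i \<notin> K" for i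
    unfolding a using that by (simp add: inner_sum_right \<beta>_frame if_distrib sum.delta cong: if_cong)
  have "g = (\<Sum>j\<in>K. a j *\<^sub>R (A *v b j)) + (\<Sum>j\<in>- K. a j *\<^sub>R (B *v b j))"
    unfolding a sum_K_compl by (simp add: frame_def)
  also have "\<dots> = (\<Sum>j\<in>K. ((D *v b j) \<bullet> g) *\<^sub>R (A *v b j)) + B *v (\<Sum>j\<in>- K. (\<beta> j \<bullet> g) *\<^sub>R b j)"
    by (simp add: D \<beta> mult_sum)
  finally show ?thesis .
qed

section \<open>The explicit generating form\<close>

abbreviation "s \<equiv> t_dprime A B K b"
abbreviation "f z \<equiv> f_dprime A B C D K b (s z)"
abbreviation "F z \<equiv> F_form A B C D K b (s z)"
abbreviation "\<Phi> \<equiv> explicit_form A B C D K b"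

lemma t_dprime_Inl: "s z (Inl j) = \<beta> j \<bullet> (Im_vec z - A *v Re_vec z)"
  by (simp add: t_dprime_def dot_lmul_matrix inner_diff_right)

lemma t_prime_eq: "j \<in> K \<Longrightarrow> t_prime D b z j = (D *v b j) \<bullet> (Im_vec z - A *v Re_vec z)"
  by (simp add: t_prime_def Db_A inner_diff_right)

lemma linear_t_prime: "linear (\<lambda>z. t_prime D b z j)"
  by (rule linearI)
    (simp_all add: t_prime_def linear_add[OF linear_Re_vec] linear_add[OF linear_Im_vec]
      linear_scale[OF linear_Re_vec] linear_scale[OF linear_Im_vec] inner_add_right algebra_simps)

lemma linear_t_dprime: "linear (\<lambda>z. s z i)"
  by (cases i; rule linearI)
    (simp_all add: t_dprime_def linear_add[OF linear_Re_vec] linear_add[OF linear_Im_vec]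
      linear_scale[OF linear_Re_vec] linear_scale[OF linear_Im_vec] inner_add_right algebra_simps)

lemma linear_f_dprime: "linear (\<lambda>z. f z i)"
  by (cases i; rule linearI)
    (simp_all add: f_dprime_def linear_add[OF linear_t_dprime] linear_scale[OF linear_t_dprime]
      sum.distrib sum_distrib_left algebra_simps)

text \<open>
  At a critical point this is the component orthogonal to \<open>ker B\<close> of the vector \<open>\<xi>\<close> that
  parametrizes the graph.
\<close>

definition xi_perp :: "complex^'n \<Rightarrow> real^'n" where
  "xi_perp z = (\<Sum>j\<in>- K. s z (Inl j) *\<^sub>R b j)"

lemma linear_xi_perp: "linear xi_perp"
  by (rule linearI)
    (simp_all add: xi_perp_def linear_add[OF linear_t_dprime] linear_scale[OF linear_t_dprime]
      sum.distrib scaleR_add_left scaleR_sum_right)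

text \<open>
  The \<open>t'\<^sub>j\<close> with \<open>j \<in> K\<close> and the \<open>t''\<^sub>j\<close> with \<open>j \<notin> K\<close> are the coordinates of \<open>y - Ax\<close> in the frame. So \<open>t' = 0\<close> gives the
  graph equation \<open>y = Ax + B\<xi>\<close>.
\<close>

lemma residual_expansion:
  "Im_vec z - A *v Re_vec z = (\<Sum>j\<in>K. t_prime D b z j *\<^sub>R (A *v b j)) + B *v xi_perp z"
  by (rule dual_frame_expansion[of "Im_vec z - A *v Re_vec z", THEN trans])
    (simp add: t_prime_eq xi_perp_def t_dprime_Inl)

lemma inner_sum_sum: "(\<Sum>i\<in>I. c i *\<^sub>R v i) \<bullet> (\<Sum>j\<in>J. d j *\<^sub>R w j)
    = (\<Sum>i\<in>I. \<Sum>j\<in>J. c i * (v i \<bullet> w j) * d j)" for v :: "'i \<Rightarrow> real^'n" and w :: "'j \<Rightarrow> real^'n"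
  unfolding inner_sum_left by (simp add: inner_sum_right sum_distrib_left mult_ac)

text \<open>
  With \<open>\<xi> = xi_perp z\<close>, \<open>y = Ax + B\<xi>\<close> and \<open>\<eta> = Cx + D\<xi>\<close>, the symplectic relations identify the
  right-hand side with \<open>(y \<bullet> \<eta> - x \<bullet> \<xi>) / 2\<close>. This is the generating function of the map
  \<open>(x, \<xi>) \<mapsto> (y, \<eta>)\<close>: its differential is \<open>\<eta> \<bullet> dy - \<xi> \<bullet> dx\<close>.
\<close>

lemma F_eq:
  "F z = 1 / 2 * ((B *v xi_perp z) \<bullet> (D *v xi_perp z)) + (B *v xi_perp z) \<bullet> (C *v Re_vec z)
    + 1 / 2 * ((A *v Re_vec z) \<bullet> (C *v Re_vec z))"
proof -
  have "Re_vec z = (\<Sum>j\<in>UNIV. s z (Inr j) *\<^sub>R b j)"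
    using b_expansion[of "Re_vec z"] unfolding t_dprime_def sum.case .
  then show ?thesis
    by (simp only: F_form_def xi_perp_def mult_sum inner_sum_sum)
qed

text \<open>
  If \<open>t'(h) = 0\<close>, the derivative of \<open>F\<close> is \<open>w \<bullet> \<eta> - u \<bullet> \<xi>\<close> for \<open>h = u + iw\<close> and \<open>\<xi> = xi_perp z\<close>,
  which already has the form of the gradient required by the graph. The sum over \<open>K\<close> corrects for directions leaving the
  subspace \<open>t' = 0\<close>; it has the same shape as the derivative of the multiplier terms \<open>\<theta>'\<^sub>j t'\<^sub>j\<close> and
  is absorbed by shifting \<open>\<theta>'\<close>.
\<close>

lemma F_along_line:
  defines "\<eta> z \<equiv> C *v Re_vec z + D *v xi_perp z"
  shows "F (z + t *\<^sub>R h) = F z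
    + t * (Im_vec h \<bullet> \<eta> z - Re_vec h \<bullet> xi_perp z - (\<Sum>j\<in>K. t_prime D b h j * ((A *v b j) \<bullet> \<eta> z)))
    + t\<^sup>2 * F h"
proof -
  let ?x = "Re_vec z" and ?u = "Re_vec h"
  have lin: "Re_vec (z + t *\<^sub>R h) = ?x + t *\<^sub>R ?u" "xi_perp (z + t *\<^sub>R h) = xi_perp z + t *\<^sub>R xi_perp h"
    by (simp_all add: linear_add[OF linear_Re_vec] linear_scale[OF linear_Re_vec]
        linear_add[OF linear_xi_perp] linear_scale[OF linear_xi_perp])
  \<comment> \<open>Polarize \<open>F_eq\<close>; its first and last summands are symmetric by \<open>BD\<close> and \<open>AC\<close>.\<close>
  have "F (z + t *\<^sub>R h) = F z + t * ((B *v xi_perp h) \<bullet> \<eta> z + (B *v xi_perp z + A *v ?x) \<bullet> (C *v ?u)) + t\<^sup>2 * F h"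
    using AC[of ?x ?u] BD[of "xi_perp z" "xi_perp h"]
    by (simp add: F_eq lin \<eta>_def matrix_vector_right_distrib matrix_vector_mult_scaleR
        inner_add_left inner_add_right inner_commute algebra_simps power2_eq_square)
  \<comment> \<open>Replace \<open>B\<close> applied to the increment of \<open>\<xi>\<close> by its value from \<open>residual_expansion\<close>.\<close>
  moreover have "(B *v xi_perp h) \<bullet> \<eta> z = Im_vec h \<bullet> \<eta> z - (A *v ?u) \<bullet> \<eta> z
      - (\<Sum>j\<in>K. t_prime D b h j * ((A *v b j) \<bullet> \<eta> z))"
  proof -
    have "B *v xi_perp h = Im_vec h - A *v ?u - (\<Sum>j\<in>K. t_prime D b h j *\<^sub>R (A *v b j))"
      using residual_expansion[of h] by (simp add: algebra_simps)
    then show ?thesis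
      by (simp add: inner_diff_left inner_sum_left)
  qed
  \<comment> \<open>Here \<open>A\<^sup>TD = I + C\<^sup>TB\<close> enters: all terms except \<open>u \<bullet> \<xi>\<close> cancel against the polarized form.\<close>
  moreover have "(A *v ?u) \<bullet> \<eta> z = Re_vec h \<bullet> xi_perp z + (B *v xi_perp z + A *v ?x) \<bullet> (C *v ?u)"
    using AC[of ?u ?x] AD[of ?u "xi_perp z"]
    by (simp add: \<eta>_def inner_add_left inner_add_right inner_commute)
  ultimately show ?thesis
    by (simp add: algebra_simps)
qed

lemma quadratic_form_explicit: "quadratic_form \<Phi>"
proof -
  have fst_lin: "linear (\<lambda>p. g (fst p))" if "linear g" for g :: "complex^'n \<Rightarrow> real"
    using linear_compose[OF linear_fst that] by (simp add: o_def)
  have theta: "linear (\<lambda>p::(complex^'n) \<times> (real^('n + 'n)). snd p $ i)" for i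
    by (rule linearI) simp_all
  have s: "quadratic_form (\<lambda>p::(complex^'n) \<times> (real^('n + 'n)). s (fst p) i * c * s (fst p) j)" for i j c
    using quadratic_form_cmult[OF quadratic_form_mult[OF fst_lin[OF linear_t_dprime] fst_lin[OF linear_t_dprime]], of c]
    by (simp add: mult_ac)
  have sq: "quadratic_form (\<lambda>p::(complex^'n) \<times> (real^('n + 'n)). (snd p $ i - f (fst p) i)\<^sup>2)" for i
    unfolding power2_eq_square
    by (intro quadratic_form_mult linear_compose_sub theta fst_lin[OF linear_f_dprime])
  show ?thesis
    unfolding explicit_form_def F_form_def case_prod_unfold
    by (intro quadratic_form_add quadratic_form_sum quadratic_form_cmult s sq
        quadratic_form_mult theta fst_lin[OF linear_t_prime])
qed

lemma deriv_explicit: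
  defines "\<eta> z \<equiv> C *v Re_vec z + D *v xi_perp z"
  shows "deriv_along (h, v) \<Phi> (z, \<theta>) =
    (\<Sum>j\<in>K. v $ Inl j * t_prime D b z j + \<theta> $ Inl j * t_prime D b h j)
    + (Im_vec h \<bullet> \<eta> z - Re_vec h \<bullet> xi_perp z - (\<Sum>j\<in>K. t_prime D b h j * ((A *v b j) \<bullet> \<eta> z)))
    + (\<Sum>i\<in>- Inl ` K. 2 * (\<theta> $ i - f z i) * (v $ i - f h i))"
proof (rule deriv_along_quadratic[where a = "\<Phi> (z, \<theta>)" and m = "\<Phi> (h, v)"])
  fix t :: real
  have "(\<Sum>j\<in>K. (\<theta> + t *\<^sub>R v) $ Inl j * t_prime D b (z + t *\<^sub>R h) j) =
      (\<Sum>j\<in>K. \<theta> $ Inl j * t_prime D b z j)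
      + t * (\<Sum>j\<in>K. v $ Inl j * t_prime D b z j + \<theta> $ Inl j * t_prime D b h j)
      + t\<^sup>2 * (\<Sum>j\<in>K. v $ Inl j * t_prime D b h j)"
    unfolding sum_distrib_left sum.distrib[symmetric]
    by (rule sum.cong)
      (simp_all add: linear_add[OF linear_t_prime] linear_scale[OF linear_t_prime]
        algebra_simps power2_eq_square)
  moreover have "(\<Sum>i\<in>- Inl ` K. ((\<theta> + t *\<^sub>R v) $ i - f (z + t *\<^sub>R h) i)\<^sup>2) =
      (\<Sum>i\<in>- Inl ` K. (\<theta> $ i - f z i)\<^sup>2)
      + t * (\<Sum>i\<in>- Inl ` K. 2 * (\<theta> $ i - f z i) * (v $ i - f h i))
      + t\<^sup>2 * (\<Sum>i\<in>- Inl ` K. (v $ i - f h i)\<^sup>2)"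
    unfolding sum_distrib_left sum.distrib[symmetric]
    by (rule sum.cong)
      (simp_all add: linear_add[OF linear_f_dprime] linear_scale[OF linear_f_dprime]
        algebra_simps power2_eq_square)
  ultimately show "\<Phi> ((z, \<theta>) + t *\<^sub>R (h, v)) = \<Phi> (z, \<theta>)
    + t *\<^sub>R ((\<Sum>j\<in>K. v $ Inl j * t_prime D b z j + \<theta> $ Inl j * t_prime D b h j)
    + (Im_vec h \<bullet> \<eta> z - Re_vec h \<bullet> xi_perp z - (\<Sum>j\<in>K. t_prime D b h j * ((A *v b j) \<bullet> \<eta> z)))
    + (\<Sum>i\<in>- Inl ` K. 2 * (\<theta> $ i - f z i) * (v $ i - f h i)))
    + t\<^sup>2 *\<^sub>R \<Phi> (h, v)"
    using F_along_line[of z t h] unfolding \<eta>_def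
    by (simp add: explicit_form_def distrib_left)
qed

lemma grad_theta_explicit:
  "grad_theta \<Phi> (z, \<theta>) $ l =
    (case l of Inl j \<Rightarrow> if j \<in> K then t_prime D b z j else 2 * (\<theta> $ l - f z l)
     | Inr j \<Rightarrow> 2 * (\<theta> $ l - f z l))"
proof -
  have zero: "Re_vec 0 = (0::real^'n)" "Im_vec 0 = (0::real^'n)" "t_prime D b 0 j = 0" "f 0 i = 0" for i j
    by (simp_all only: linear_0[OF linear_Re_vec] linear_0[OF linear_Im_vec]
        linear_0[OF linear_t_prime] linear_0[OF linear_f_dprime])
  have "grad_theta \<Phi> (z, \<theta>) $ l = (\<Sum>j\<in>K. axis l 1 $ Inl j * t_prime D b z j)
      + (\<Sum>i\<in>- Inl ` K. 2 * (\<theta> $ i - f z i) * axis l 1 $ i)"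
    by (simp add: grad_theta_def d_theta_def deriv_explicit zero)
  also have "\<dots> = (case l of Inl j \<Rightarrow> if j \<in> K then t_prime D b z j else 2 * (\<theta> $ l - f z l)
     | Inr j \<Rightarrow> 2 * (\<theta> $ l - f z l))"
    by (auto simp: axis_def if_distrib if_distribR sum.delta split: sum.split cong: if_cong)
  finally show ?thesis .
qed

lemma critical_iff:
  "grad_theta \<Phi> (z, \<theta>) = 0 \<longleftrightarrow>
    (\<forall>j\<in>K. t_prime D b z j = 0) \<and> (\<forall>i\<in>- Inl ` K. \<theta> $ i = f z i)"
proof
  assume "grad_theta \<Phi> (z, \<theta>) = 0"
  then have *: "(case l of Inl j \<Rightarrow> if j \<in> K then t_prime D b z j else 2 * (\<theta> $ l - f z l)
     | Inr j \<Rightarrow> 2 * (\<theta> $ l - f z l)) = 0" for l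
    by (metis grad_theta_explicit zero_index)
  have "t_prime D b z j = 0" if "j \<in> K" for j
    using *[of "Inl j"] that by simp
  moreover have "\<theta> $ i = f z i" if "i \<in> - Inl ` K" for i
    using *[of i] that by (auto split: sum.splits if_splits)
  ultimately show "(\<forall>j\<in>K. t_prime D b z j = 0) \<and> (\<forall>i\<in>- Inl ` K. \<theta> $ i = f z i)"
    by blast
next
  assume "(\<forall>j\<in>K. t_prime D b z j = 0) \<and> (\<forall>i\<in>- Inl ` K. \<theta> $ i = f z i)"
  then show "grad_theta \<Phi> (z, \<theta>) = 0"
    by (auto simp: vec_eq_iff grad_theta_explicit split: sum.split)
qed

text \<open>
  The point of the graph parametrized by a critical \<open>(z, \<theta>)\<close>. The \<open>ker B\<close> component is \<open>\<theta>'\<close>, shifted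
  by the correction term of \<open>F_along_line\<close>.
\<close>

definition xi_of :: "complex^'n \<Rightarrow> real^('n + 'n) \<Rightarrow> real^'n" where
  "xi_of z \<theta> = xi_perp z
    + (\<Sum>j\<in>K. (\<theta> $ Inl j - (A *v b j) \<bullet> (C *v Re_vec z + D *v xi_perp z)) *\<^sub>R b j)"

text \<open>
  The squares have vanishing differential at a critical point. The differentials of the
  multiplier terms and the correction in \<open>F_along_line\<close> combine to \<open>w \<bullet> Dv - u \<bullet> v\<close> where \<open>v\<close> is the
  \<open>ker B\<close> component of \<open>\<xi>\<close>.
\<close>

lemma grad_z_critical:
  assumes "grad_theta \<Phi> (z, \<theta>) = 0"
  shows "- 2 *\<^sub>R grad_z \<Phi> (z, \<theta>) = complex_vec (xi_of z \<theta>) (C *v Re_vec z + D *v xi_of z \<theta>)"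
proof -
  let ?\<eta> = "C *v Re_vec z + D *v xi_perp z"
  let ?c = "\<lambda>j. \<theta> $ Inl j - (A *v b j) \<bullet> ?\<eta>"
  have deriv: "deriv_along (h, 0) \<Phi> (z, \<theta>)
      = Im_vec h \<bullet> (C *v Re_vec z + D *v xi_of z \<theta>) - Re_vec h \<bullet> xi_of z \<theta>" for h
  proof -
    have "deriv_along (h, 0) \<Phi> (z, \<theta>) = Im_vec h \<bullet> ?\<eta> - Re_vec h \<bullet> xi_perp z + (\<Sum>j\<in>K. ?c j * t_prime D b h j)"
      using assms by (simp add: deriv_explicit critical_iff sum_subtractf[symmetric] algebra_simps)
    also have "(\<Sum>j\<in>K. ?c j * t_prime D b h j)
        = Im_vec h \<bullet> (D *v (\<Sum>j\<in>K. ?c j *\<^sub>R b j)) - Re_vec h \<bullet> (\<Sum>j\<in>K. ?c j *\<^sub>R b j)"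
      unfolding mult_sum inner_sum_right sum_subtractf[symmetric]
      by (rule sum.cong) (simp_all add: t_prime_def inner_commute algebra_simps)
    finally show ?thesis
      by (simp add: xi_of_def matrix_vector_right_distrib inner_add_right)
  qed
  have ax: "Re_vec (axis j 1) = axis j 1" "Im_vec (axis j 1) = 0"
      "Re_vec (axis j \<i>) = 0" "Im_vec (axis j \<i>) = axis j 1" for j :: 'n
    by (simp_all add: vec_eq_iff Re_vec_def Im_vec_def axis_def)
  show ?thesis
    unfolding vec_eq_iff
    by (simp add: grad_z_def d_z_def deriv_along_of_real_quadratic_form[OF quadratic_form_explicit]
        deriv ax inner_axis' complex_vec_def complex_eq_iff field_simps)
qed

text \<open>
  A critical point lies over the graph point with parameters \<open>x\<close> and \<open>xi_of z \<theta>\<close>. Conversely a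
  graph point satisfies \<open>t'(z) = 0\<close>, and its \<open>\<xi>\<close> differs from \<open>xi_perp z\<close> by an element of \<open>ker B\<close>,
  whose coordinates determine \<open>\<theta>'\<close>.
\<close>

lemma generates_graph_explicit: "generates_graph \<Phi> A B C D"
proof -
  have "(z, - 2 *\<^sub>R grad_z \<Phi> (z, \<theta>)) \<in> graphC A B C D" if crit: "grad_theta \<Phi> (z, \<theta>) = 0" for z \<theta>
  proof -
    have "Im_vec z - A *v Re_vec z = B *v xi_perp z"
      using crit residual_expansion[of z] by (simp add: critical_iff)
    also have "\<dots> = B *v xi_of z \<theta>"
      by (simp add: xi_of_def matrix_vector_right_distrib mult_sum)
    finally have "Im_vec z = A *v Re_vec z + B *v xi_of z \<theta>"
      by (simp add: algebra_simps)
    then have "z = complex_vec (Re_vec z) (A *v Re_vec z + B *v xi_of z \<theta>)"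
      by (metis complex_vec_simps(3))
    then show ?thesis
      unfolding grad_z_critical[OF crit] graphC_def by blast
  qed
  moreover have "\<exists>z \<theta>. p = (z, - 2 *\<^sub>R grad_z \<Phi> (z, \<theta>)) \<and> grad_theta \<Phi> (z, \<theta>) = 0"
    if "p \<in> graphC A B C D" for p
  proof -
    obtain x \<xi> where p: "p = (complex_vec x (A *v x + B *v \<xi>), complex_vec \<xi> (C *v x + D *v \<xi>))"
      using \<open>p \<in> graphC A B C D\<close> unfolding graphC_def by blast
    define z where "z = complex_vec x (A *v x + B *v \<xi>)"
    have tp: "t_prime D b z j = 0" if "j \<in> K" for j
      using that by (simp add: t_prime_eq z_def Db_B)
    then have "B *v (\<xi> - xi_perp z) = 0"
      using residual_expansion[of z] by (simp add: z_def matrix_vector_mult_diff_distrib)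
    then have ker: "\<xi> - xi_perp z = (\<Sum>j\<in>K. (b j \<bullet> (\<xi> - xi_perp z)) *\<^sub>R b j)"
      by (rule ker_expansion)
    \<comment> \<open>Solve the definition of \<open>xi_of\<close> for \<open>\<theta>'\<close>, and take \<open>\<theta>'' = f''\<close> as criticality demands.\<close>
    define \<theta> :: "real^('n + 'n)" where
      "\<theta> = (\<chi> i. if i \<in> Inl ` K
        then b (projl i) \<bullet> (\<xi> - xi_perp z) + (A *v b (projl i)) \<bullet> (C *v x + D *v xi_perp z) else f z i)"
    have crit: "grad_theta \<Phi> (z, \<theta>) = 0"
      unfolding critical_iff using tp by (simp add: \<theta>_def)
    have "xi_of z \<theta> = xi_perp z + (\<Sum>j\<in>K. (b j \<bullet> (\<xi> - xi_perp z)) *\<^sub>R b j)"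
      by (simp add: xi_of_def \<theta>_def z_def)
    then have "xi_of z \<theta> = \<xi>"
      unfolding ker[symmetric] by simp
    then have "p = (z, - 2 *\<^sub>R grad_z \<Phi> (z, \<theta>))"
      unfolding grad_z_critical[OF crit] p by (simp add: z_def)
    with crit show ?thesis
      by blast
  qed
  ultimately show ?thesis
    unfolding generates_graph_def by (intro set_eqI iffI) blast+
qed

end

theorem theorem1:
  fixes A B C D :: "real^'n::finite^'n"
  assumes "block_matrix A B C D \<in> Sp"
  shows "(\<exists>\<Phi>. quadratic_form \<Phi> \<and> generates_graph \<Phi> A B C D \<and> omega_formula \<Phi>) \<and>
    (\<forall>K b. adapted_basis B K b \<longrightarrow>
       quadratic_form (explicit_form A B C D K b) \<and>
       generates_graph (explicit_form A B C D K b) A B C D \<and>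
       omega_formula (explicit_form A B C D K b))"
proof -
  interpret symplectic_blocks A B C D
    using assms by (rule symplectic_blocksI)
  have explicit: "quadratic_form (explicit_form A B C D K b) \<and>
       generates_graph (explicit_form A B C D K b) A B C D \<and>
       omega_formula (explicit_form A B C D K b)" if "adapted_basis B K b" for K b
  proof -
    interpret adapted_blocks A B C D K b
      by unfold_locales (rule that)
    show ?thesis
      using quadratic_form_explicit generates_graph_explicit omega_formula_quadratic_form by blast
  qed
  moreover obtain K b where "adapted_basis B K b"
    by (rule adapted_basis_exists)
  ultimately show ?thesis
    by blast
qed

end
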